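(* Let $k$, $r$ and $d$ be positive integers with $d \ge 2$, and let $G$ be a graph on $n = |V(G)|$ vertices with minimum degree at least $d$ and girth at least $2k+1$. Then $$\gamma^{t}_{(k,r)}(G) \leq \frac{2nr}{(d-1)^k} + n r e^{-r/4}.$$
   Context: For a graph $G$ and vertices $u,v$, $d(u,v)$ denotes the length of a shortest path between $u$ and $v$. For $v \in V(G)$, $N_k(v) = \{u \in V(G) : u \neq v,\ d(u,v) \le k\}$. A set $S \subseteq V(G)$ is a total $(k,r)$-dominating set of $G$ if for every vertex $u \in V(G)$, $|N_k(u) \cap S| \ge r$, i.e. every vertex is within distance $k$ of at least $r$ vertices of $S$ other than itself. The total $(k,r)$-domination number $\gamma^{t}_{(k,r)}(G)$ is the minimum cardinality of a total $(k,r)$-dominating set of $G$. The girth of $G$ is the length of a shortest cycle in $G$.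
   Formalization: The formal statement also assumes that G has at least one total (k,r)-dominating set, since otherwise the total (k,r)-domination number is a minimum over the empty set (e.g. the complete graph on 4 vertices with k = 1, r = 10). *)

theory Defs
  imports Complex_Main "HOL-Library.Extended_Nat" "Graph_Theory.Arc_Walk"
begin

text \<open>
  Finite simple graphs are the symmetric loop-free digraphs without parallel arcs of the locale
  \<open>graph\<close>: an edge $uv$ is the pair of arcs $(u,v)$ and $(v,u)$, so the degree of a vertex is its
  out-degree.
\<close>

definition min_degree :: "('a,'b) pre_digraph \<Rightarrow> enat" where
  "min_degree G = (INF v\<in>verts G. enat (out_degree G v))"

text \<open>The infimum is \<open>\<infinity>\<close> if \<open>u\<close> and \<open>v\<close> lie in different components.\<close>

definition graph_dist :: "('a,'b) pre_digraph \<Rightarrow> 'a \<Rightarrow> 'a \<Rightarrow> enat" where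
  "graph_dist G u v = (INF p\<in>{p. pre_digraph.apath G u p v}. enat (length p))"

text \<open>
  The bound \<open>3 \<le> length p\<close> excludes the closed walks $u,v,u$ along a single edge, which
  \<open>pre_digraph.cycle\<close> admits in a symmetric digraph. A forest has girth \<open>\<infinity>\<close>.
\<close>

definition girth :: "('a,'b) pre_digraph \<Rightarrow> enat" where
  "girth G = (INF p\<in>{p. pre_digraph.cycle G p \<and> 3 \<le> length p}. enat (length p))"

definition k_neighbours :: "('a,'b) pre_digraph \<Rightarrow> nat \<Rightarrow> 'a \<Rightarrow> 'a set" where
  "k_neighbours G k v = {u \<in> verts G. u \<noteq> v \<and> graph_dist G u v \<le> enat k}"

definition total_dominating :: "('a,'b) pre_digraph \<Rightarrow> nat \<Rightarrow> nat \<Rightarrow> 'a set \<Rightarrow> bool" where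
  "total_dominating G k r S \<longleftrightarrow>
     S \<subseteq> verts G \<and> (\<forall>u\<in>verts G. r \<le> card (k_neighbours G k u \<inter> S))"

text \<open>
  Meaningful only if \<open>G\<close> has a total $(k,r)$-dominating set, that is, if every vertex has at
  least \<open>r\<close> other vertices within distance \<open>k\<close>.
\<close>

definition total_domination_number :: "('a,'b) pre_digraph \<Rightarrow> nat \<Rightarrow> nat \<Rightarrow> nat" where
  "total_domination_number G k r = (LEAST m. \<exists>S. total_dominating G k r S \<and> card S = m)"

end

theory Submission
  imports Defs
begin

text \<open>
  Grow the breadth-first layers around a vertex. Two neighbours of \<open>w\<close> that are at most as far from
  the root as \<open>w\<close> would be joined through the root by a walk avoiding \<open>w\<close>, which closes up
  to a short cycle; hence up to depth \<open>k\<close> every vertex has at least $d-1$ children and no child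
  has two parents, so that every vertex has at least $(d-1)^k$ vertices within distance \<open>k\<close>.

  If $2r \ge (d-1)^k$, the bound exceeds \<open>n\<close>. Otherwise choose every vertex independently with
  probability $p = 2r/(d-1)^k$. A vertex sees fewer than \<open>r\<close> chosen vertices with probability
  at most $2^r (1 - p/2)^{(d-1)^k} \le (2/e)^r \le e^{-r/4}$; adding \<open>r\<close> vertices for each
  such vertex repairs the random set.
\<close>

section \<open>Random sets with alteration\<close>

text \<open>First-moment principle: if every \<open>c x\<close> exceeded \<open>C\<close>, so would
  the average, because the weights sum to 1.\<close>

lemma exists_le_weighted_average:
  fixes w c :: "'a \<Rightarrow> real"
  assumes fin: "finite A" and nonneg: "\<And>x. x \<in> A \<Longrightarrow> 0 \<le> w x" and total: "sum w A = 1"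
    and avg: "(\<Sum>x\<in>A. w x * c x) \<le> C"
  shows "\<exists>x\<in>A. c x \<le> C"
proof (rule ccontr)
  assume "\<not> ?thesis"
  then have gt: "C < c x" if "x \<in> A" for x
    using that by force
  obtain y where y: "y \<in> A" "w y \<noteq> 0"
    using total by (metis sum.neutral zero_neq_one)
  have "(\<Sum>x\<in>A. w x * C) < (\<Sum>x\<in>A. w x * c x)"
  proof (rule sum_strict_mono_ex1[OF fin])
    show "\<forall>x\<in>A. w x * C \<le> w x * c x"
      using nonneg gt by (simp add: mult_left_mono less_imp_le)
    show "\<exists>x\<in>A. w x * C < w x * c x"
      using y nonneg[of y] gt[of y] by (intro bexI[of _ y]) auto
  qed
  moreover have "(\<Sum>x\<in>A. w x * C) = C"
    using total by (simp flip: sum_distrib_right)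
  ultimately show False
    using avg by simp
qed

text \<open>For \<open>S \<subseteq> V\<close>, the probability that \<open>S\<close> arises when
  each element of \<open>V\<close> is kept independently with probability \<open>p\<close>.
  Expectations are thus finite sums over \<open>Pow V\<close>.\<close>

definition subset_weight :: "real \<Rightarrow> 'a set \<Rightarrow> 'a set \<Rightarrow> real" where
  "subset_weight p V S = p ^ card S * (1 - p) ^ card (V - S)"

lemma subset_weight_nonneg: "0 \<le> p \<Longrightarrow> p \<le> 1 \<Longrightarrow> 0 \<le> subset_weight p V S"
  by (simp add: subset_weight_def)

lemma sum_subset_weight:
  assumes "finite V"
  shows "sum (subset_weight p V) (Pow V) = 1"
  using prod_add[OF assms, of "\<lambda>_. p" "\<lambda>_. 1 - p"] by (simp add: subset_weight_def)

text \<open>Replacing the rejection factor of \<open>v\<close> by 0 removes exactly the sets without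
  \<open>v\<close>. The product over \<open>V\<close> then has the factor \<open>p\<close> at
  \<open>v\<close> and 1 elsewhere.\<close>

lemma subset_weight_mem:
  assumes fin: "finite V" and v: "v \<in> V"
  shows "(\<Sum>S\<in>Pow V. subset_weight p V S * of_bool (v \<in> S)) = p"
proof -
  have "(\<Sum>S\<in>Pow V. subset_weight p V S * of_bool (v \<in> S))
      = (\<Sum>S\<in>Pow V. (\<Prod>x\<in>S. p) * (\<Prod>x\<in>V - S. if x = v then 0 else 1 - p))"
  proof (rule sum.cong[OF refl])
    fix S assume "S \<in> Pow V"
    have "(\<Prod>x\<in>V - S. if x = v then 0 else 1 - p) = (1 - p) ^ card (V - S) * of_bool (v \<in> S)"
    proof (cases "v \<in> S")
      case True
      then have "(\<Prod>x\<in>V - S. if x = v then 0 else 1 - p) = (\<Prod>x\<in>V - S. 1 - p)"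
        by (intro prod.cong) auto
      with True show ?thesis by simp
    next
      case False
      with v fin show ?thesis by (auto simp: prod_zero_iff)
    qed
    then show "subset_weight p V S * of_bool (v \<in> S)
        = (\<Prod>x\<in>S. p) * (\<Prod>x\<in>V - S. if x = v then 0 else 1 - p)"
      by (simp add: subset_weight_def)
  qed
  also have "\<dots> = (\<Prod>x\<in>V. p + (if x = v then 0 else 1 - p))"
    by (rule prod_add[OF fin, symmetric])
  also have "\<dots> = (\<Prod>x\<in>V. if x = v then p else 1)"
    by (rule prod.cong) auto
  also have "\<dots> = p"
    using fin v by simp
  finally show ?thesis .
qed

text \<open>Linearity of expectation over the membership indicators.\<close>

lemma subset_weight_card:
  assumes fin: "finite V"
  shows "(\<Sum>S\<in>Pow V. subset_weight p V S * real (card S)) = real (card V) * p"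
proof -
  have "(\<Sum>S\<in>Pow V. subset_weight p V S * real (card S))
      = (\<Sum>S\<in>Pow V. \<Sum>v\<in>V. subset_weight p V S * of_bool (v \<in> S))"
  proof (rule sum.cong[OF refl])
    fix S assume "S \<in> Pow V"
    then have "real (card S) = (\<Sum>v\<in>V. of_bool (v \<in> S))"
      using fin by (simp add: Int_absorb1)
    then show "subset_weight p V S * real (card S)
        = (\<Sum>v\<in>V. subset_weight p V S * of_bool (v \<in> S))"
      by (simp only: sum_distrib_left)
  qed
  also have "\<dots> = (\<Sum>v\<in>V. \<Sum>S\<in>Pow V. subset_weight p V S * of_bool (v \<in> S))"
    by (rule sum.swap)
  also have "\<dots> = real (card V) * p"
    using subset_weight_mem[OF fin] by simp
  finally show ?thesis .
qed

text \<open>Generating function of the number of hits at 1/2: by independence each element of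
  \<open>N\<close> contributes \<open>p / 2 + (1 - p)\<close>, and every other element contributes
  1.\<close>

lemma subset_weight_half_power:
  assumes fin: "finite V" and N: "N \<subseteq> V"
  shows "(\<Sum>S\<in>Pow V. subset_weight p V S * (1 / 2) ^ card (N \<inter> S)) = (1 - p / 2) ^ card N"
proof -
  have "(\<Sum>S\<in>Pow V. subset_weight p V S * (1 / 2) ^ card (N \<inter> S))
      = (\<Sum>S\<in>Pow V. (\<Prod>x\<in>S. p * (if x \<in> N then 1 / 2 else 1)) * (\<Prod>x\<in>V - S. 1 - p))"
  proof (rule sum.cong[OF refl])
    fix S assume "S \<in> Pow V"
    then have "finite S" using fin finite_subset by auto
    then have "(\<Prod>x\<in>S. if x \<in> N then 1 / 2 else 1) = (1 / 2 :: real) ^ card (N \<inter> S)"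
      by (simp add: prod.If_cases Int_commute)
    then show "subset_weight p V S * (1 / 2) ^ card (N \<inter> S)
        = (\<Prod>x\<in>S. p * (if x \<in> N then 1 / 2 else 1)) * (\<Prod>x\<in>V - S. 1 - p)"
      by (simp add: subset_weight_def prod.distrib)
  qed
  also have "\<dots> = (\<Prod>x\<in>V. p * (if x \<in> N then 1 / 2 else 1) + (1 - p))"
    by (rule prod_add[OF fin, symmetric])
  also have "\<dots> = (\<Prod>x\<in>V. if x \<in> N then 1 - p / 2 else 1)"
    by (rule prod.cong) auto
  also have "\<dots> = (1 - p / 2) ^ card N"
    using fin N by (simp add: prod.If_cases Int_absorb1)
  finally show ?thesis .
qed

text \<open>A Chernoff bound: Markov's inequality applied to 2 to the power
  \<open>r - card (N \<inter> S)\<close>.\<close>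

lemma subset_weight_few_hits:
  assumes fin: "finite V" and N: "N \<subseteq> V" and p: "0 \<le> p" "p \<le> 1"
    and r: "2 * real r \<le> p * real (card N)"
  shows "(\<Sum>S\<in>Pow V. subset_weight p V S * of_bool (card (N \<inter> S) < r)) \<le> exp (- real r / 4)"
proof -
  have "(\<Sum>S\<in>Pow V. subset_weight p V S * of_bool (card (N \<inter> S) < r))
      \<le> (\<Sum>S\<in>Pow V. 2 ^ r * (subset_weight p V S * (1 / 2) ^ card (N \<inter> S)))"
  proof (rule sum_mono)
    fix S
    have "of_bool (card (N \<inter> S) < r) \<le> (2 ^ r * (1 / 2) ^ card (N \<inter> S) :: real)"
      by (auto simp: power_one_over field_simps)
    from mult_left_mono[OF this subset_weight_nonneg[OF p, of V S]]
    show "subset_weight p V S * of_bool (card (N \<inter> S) < r)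
        \<le> 2 ^ r * (subset_weight p V S * (1 / 2) ^ card (N \<inter> S))"
      by (simp only: mult_ac)
  qed
  also have "\<dots> = 2 ^ r * (1 - p / 2) ^ card N"
    by (simp add: subset_weight_half_power[OF fin N] flip: sum_distrib_left)
  also have "\<dots> \<le> exp (3 / 4) ^ r * exp (- p / 2) ^ card N"
  proof (intro mult_mono power_mono)
    \<comment> \<open>The quadratic Taylor bound gives 1 + 3/4 + 9/32 > 2. The exponent 3/4 leaves
      \<open>- r / 4\<close> once \<open>p * card N / 2 \<ge> r\<close> is subtracted.\<close>
    show "2 \<le> exp (3 / 4 :: real)"
      using exp_lower_Taylor_quadratic[of "3 / 4 :: real"] by (simp add: power2_eq_square)
    show "1 - p / 2 \<le> exp (- p / 2)"
      using exp_ge_add_one_self[of "- p / 2"] by simp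
  qed (use p in auto)
  also have "\<dots> = exp (real r * (3 / 4) - p * real (card N) / 2)"
    by (simp add: exp_diff exp_minus field_simps flip: exp_of_nat_mult exp_add)
  also have "\<dots> \<le> exp (- real r / 4)"
    using r by simp
  finally show ?thesis .
qed

text \<open>Alteration: take a random set and add \<open>r\<close> elements of \<open>N v\<close>
  for every \<open>v\<close> that it hits fewer than \<open>r\<close> times. The two summands bound
  the expected sizes of the random set and of the repairs.\<close>

lemma exists_small_set_with_many_hits:
  fixes N :: "'a \<Rightarrow> 'a set"
  assumes fin: "finite V" and N: "\<And>v. v \<in> V \<Longrightarrow> N v \<subseteq> V"
    and p: "0 \<le> p" "p \<le> 1"
    and r: "\<And>v. v \<in> V \<Longrightarrow> 2 * real r \<le> p * real (card (N v))"
  shows "\<exists>T\<subseteq>V. (\<forall>v\<in>V. r \<le> card (N v \<inter> T)) \<and>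
           real (card T) \<le> real (card V) * p + real (card V) * real r * exp (- real r / 4)"
proof -
  define bad where "bad S = {v \<in> V. card (N v \<inter> S) < r}" for S
  let ?C = "real (card V) * p + real (card V) * real r * exp (- real r / 4)"
  let ?w = "subset_weight p V"
  have bad_card: "real (card (bad S)) = (\<Sum>v\<in>V. of_bool (card (N v \<inter> S) < r))" for S
    using fin by (simp add: bad_def Int_def)
  have "(\<Sum>S\<in>Pow V. ?w S * real (card (bad S)))
      = (\<Sum>v\<in>V. \<Sum>S\<in>Pow V. ?w S * of_bool (card (N v \<inter> S) < r))"
    by (simp only: bad_card sum_distrib_left) (rule sum.swap)
  also have "\<dots> \<le> (\<Sum>v\<in>V. exp (- real r / 4))"
    using subset_weight_few_hits[OF fin N p r] by (intro sum_mono)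
  finally have bad_avg: "(\<Sum>S\<in>Pow V. ?w S * real (card (bad S))) \<le> real (card V) * exp (- real r / 4)"
    by simp
  \<comment> \<open>The averaged cost is an upper bound for the size of the repaired set.\<close>
  have "(\<Sum>S\<in>Pow V. ?w S * (real (card S) + real r * real (card (bad S))))
      = (\<Sum>S\<in>Pow V. ?w S * real (card S)) + real r * (\<Sum>S\<in>Pow V. ?w S * real (card (bad S)))"
    by (simp add: sum.distrib sum_distrib_left algebra_simps)
  also have "\<dots> \<le> ?C"
    using mult_left_mono[OF bad_avg, of "real r"]
    by (simp add: subset_weight_card[OF fin] mult.assoc mult.left_commute[of "real r"])
  finally have "\<exists>S\<in>Pow V. real (card S) + real r * real (card (bad S)) \<le> ?C"
    using fin subset_weight_nonneg[OF p] sum_subset_weight[OF fin]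
    by (intro exists_le_weighted_average[of "Pow V" ?w]) auto
  then obtain S where S: "S \<subseteq> V" "real (card S) + real r * real (card (bad S)) \<le> ?C"
    by blast
  \<comment> \<open>Repair is possible because \<open>p \<le> 1\<close> turns the hypothesis into
    \<open>2 * r \<le> card (N v)\<close>.\<close>
  have "\<exists>X\<subseteq>N v. card X = r" if "v \<in> V" for v
  proof -
    have "p * real (card (N v)) \<le> real (card (N v))"
      using p by (simp add: mult_left_le_one_le)
    with r[OF that] have "r \<le> card (N v)" by linarith
    then show ?thesis by (meson obtain_subset_with_card_n)
  qed
  then obtain X where X: "\<And>v. v \<in> V \<Longrightarrow> X v \<subseteq> N v \<and> card (X v) = r"
    by metis
  define T where "T = S \<union> (\<Union>v\<in>bad S. X v)"
  have bad_V: "bad S \<subseteq> V" by (auto simp: bad_def)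
  have T_V: "T \<subseteq> V"
    using S(1) bad_V X N unfolding T_def by blast
  have fin_T: "finite T" using T_V fin finite_subset by blast
  have hits: "r \<le> card (N v \<inter> T)" if v: "v \<in> V" for v
  proof (cases "v \<in> bad S")
    case True
    then have "X v \<subseteq> N v \<inter> T" using X[OF v] by (auto simp: T_def)
    then show ?thesis using X[OF v] fin_T card_mono by (metis finite_Int)
  next
    case False
    then have "r \<le> card (N v \<inter> S)" using v by (simp add: bad_def)
    also have "\<dots> \<le> card (N v \<inter> T)"
      using fin_T by (intro card_mono) (auto simp: T_def)
    finally show ?thesis .
  qed
  have "card T \<le> card S + card (\<Union>v\<in>bad S. X v)"
    unfolding T_def by (rule card_Un_le)
  also have "card (\<Union>v\<in>bad S. X v) \<le> (\<Sum>v\<in>bad S. card (X v))"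
    using finite_subset[OF bad_V fin] by (rule card_UN_le)
  also have "\<dots> = (\<Sum>v\<in>bad S. r)"
    using X bad_V by (intro sum.cong) auto
  finally have "card T \<le> card S + r * card (bad S)"
    by (simp add: mult.commute)
  then have "real (card T) \<le> real (card S + r * card (bad S))"
    by (simp only: of_nat_le_iff)
  with S(2) have "real (card T) \<le> ?C" by simp
  with T_V hits show ?thesis by blast
qed

section \<open>Breadth-first layers\<close>

text \<open>The extracted path repeats no arc and uses only arcs of \<open>p\<close>.\<close>

lemma (in wf_digraph) length_awalk_to_apath_le:
  assumes "awalk u p v"
  shows "length (awalk_to_apath p) \<le> length p"
proof -
  have "apath u (awalk_to_apath p) v" by (rule apath_awalk_to_apath[OF assms])
  then have "distinct (awalk_to_apath p)"
    unfolding apath_def by (blast intro: distinct_verts_imp_distinct)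
  then have "length (awalk_to_apath p) = card (set (awalk_to_apath p))"
    by (simp add: distinct_card)
  also have "\<dots> \<le> card (set p)"
    using awalk_to_apath_subset[OF assms] by (intro card_mono) auto
  also have "\<dots> \<le> length p" by (rule card_length)
  finally show ?thesis .
qed

lemma (in sym_digraph) reverse_arc:
  assumes "e \<in> arcs G"
  obtains f where "f \<in> arcs G" "tail G f = head G e" "head G f = tail G e"
  using assms sym_arcs symmetric_conv by metis

text \<open>The vertex set is recorded so that avoidance of a vertex survives reversal.\<close>

lemma (in sym_digraph) reverse_awalk:
  assumes "awalk u p v"
  shows "\<exists>q. awalk v q u \<and> length q = length p \<and> set (awalk_verts v q) = set (awalk_verts u p)"
  using assms
proof (induction p arbitrary: u)
  case Nil
  then show ?case by (auto simp: awalk_Nil_iff intro!: exI[of _ "[]"])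
next
  case (Cons e p)
  then have e: "e \<in> arcs G" "tail G e = u" and p: "awalk (head G e) p v"
    by (auto simp: awalk_Cons_iff)
  obtain q where q: "awalk v q (head G e)" "length q = length p"
    "set (awalk_verts v q) = set (awalk_verts (head G e) p)"
    using Cons.IH[OF p] by blast
  obtain f where f: "f \<in> arcs G" "tail G f = head G e" "head G f = u"
    using reverse_arc[OF e(1)] e(2) by metis
  have "awalk (head G e) [f] u"
    using f by (auto simp: awalk_simps)
  moreover have "head G e \<in> set (awalk_verts (head G e) p)"
    using p by (rule hd_in_awalk_verts)
  ultimately show ?case
    using q e f by (intro exI[of _ "q @ [f]"]) (auto simp: set_awalk_verts_append)
qed

text \<open>The vertices at distance exactly \<open>i\<close> from \<open>v\<close>, measured by
  walks, which may be concatenated freely, unlike paths. Walks run towards the root, so stepping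
  outwards prepends an arc; vertices that cannot reach \<open>v\<close> lie in no layer.\<close>

definition (in pre_digraph) layer :: "'a \<Rightarrow> nat \<Rightarrow> 'a set" where
  "layer v i = {u. (\<exists>p. awalk u p v \<and> length p = i) \<and> (\<forall>p. awalk u p v \<longrightarrow> i \<le> length p)}"

context wf_digraph
begin

lemma layer_subset_verts: "layer v i \<subseteq> verts G"
  by (auto simp: layer_def)

lemma layer_0: "v \<in> verts G \<Longrightarrow> v \<in> layer v 0"
  by (auto simp: layer_def awalk_Nil_iff)

lemma layer_unique: "u \<in> layer v i \<Longrightarrow> u \<in> layer v j \<Longrightarrow> i = j"
  by (auto simp: layer_def intro: antisym)

lemma awalk_in_layer:
  assumes "awalk u p v"
  obtains i where "i \<le> length p" "u \<in> layer v i"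
proof -
  let ?P = "\<lambda>i. \<exists>q. awalk u q v \<and> length q = i"
  have "?P (length p)" using assms by blast
  then have "?P (Least ?P)" "Least ?P \<le> length p"
    by (rule LeastI, rule Least_le)
  moreover have "Least ?P \<le> length q" if "awalk u q v" for q
    using that by (intro Least_le) blast
  ultimately show ?thesis
    by (intro that[of "Least ?P"]) (auto simp: layer_def)
qed

text \<open>If \<open>w\<close> were on \<open>p\<close>, the rest of \<open>p\<close> from
  \<open>w\<close> to \<open>v\<close> would already have length at least \<open>j\<close>, leaving
  no arc between \<open>a\<close> and \<open>w\<close>.\<close>

lemma not_on_shortest_awalk:
  assumes w: "w \<in> layer v j" and p: "awalk a p v" and "length p \<le> j" and "a \<noteq> w"
  shows "w \<notin> set (awalk_verts a p)"
proof
  assume "w \<in> set (awalk_verts a p)"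
  then obtain q s where qs: "p = q @ s" "awalk a q w" "awalk w s v"
    using awalk_decomp[OF p] by blast
  then have "j \<le> length s" using w by (auto simp: layer_def)
  then have "length q = 0" using qs(1) \<open>length p \<le> j\<close> by (simp del: length_0_conv)
  with qs(2) \<open>a \<noteq> w\<close> show False by (simp add: awalk_Nil_iff)
qed

end

section \<open>Large girth forces the layers to grow\<close>

context graph
begin

text \<open>Shortening \<open>p\<close> to a path keeps it away from \<open>w\<close>, so
  \<open>e\<close> and \<open>f\<close> close it to a cycle through \<open>w\<close>.\<close>

lemma cycle_through_vertex:
  assumes e: "e \<in> arcs G" "tail G e = w" "head G e = a"
    and f: "f \<in> arcs G" "tail G f = b" "head G f = w"
    and p: "awalk a p b" and w: "w \<notin> set (awalk_verts a p)" and "a \<noteq> b"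
  shows "girth G \<le> enat (length p + 2)"
proof -
  let ?t = "awalk_to_apath p"
  have path: "apath a ?t b" by (rule apath_awalk_to_apath[OF p])
  then have t: "awalk a ?t b" "distinct (awalk_verts a ?t)" by (auto simp: apath_def)
  have "set (awalk_verts a ?t) \<subseteq> set (awalk_verts a p)"
    using awalk_to_apath_subset[OF p] by (auto simp: set_awalk_verts[OF p] set_awalk_verts[OF t(1)])
  with w have w_t: "w \<notin> set (awalk_verts a ?t)" by blast
  \<comment> \<open>A nonempty path gives the closed walk at least three arcs, as
    \<open>girth\<close> demands.\<close>
  have "?t \<noteq> []" using t(1) \<open>a \<noteq> b\<close> by (auto simp: awalk_Nil_iff)
  have "awalk b [f] w" using f by (auto simp: awalk_simps)
  then have tf: "awalk a (?t @ [f]) w" using t(1) by auto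
  then have walk: "awalk w (e # ?t @ [f]) w" using e by (auto simp: awalk_Cons_iff)
  have "awalk_verts a (?t @ [f]) = awalk_verts a ?t @ [w]"
    using awalk_verts_append[OF tf] f by simp
  then have "distinct (tl (awalk_verts w (e # ?t @ [f])))"
    using e t(2) w_t by simp
  with walk have "cycle (e # ?t @ [f])" by (auto simp: cycle_def)
  moreover have "3 \<le> length (e # ?t @ [f])"
    using \<open>?t \<noteq> []\<close> by (cases ?t) auto
  ultimately have "girth G \<le> enat (length (e # ?t @ [f]))"
    unfolding girth_def by (intro INF_lower) blast
  also have "\<dots> \<le> enat (length p + 2)"
    using length_awalk_to_apath_le[OF p] by simp
  finally show ?thesis .
qed

text \<open>Shortest walks from \<open>a\<close> and \<open>b\<close> to the root avoid
  \<open>w\<close>. Joined at the root they connect \<open>a\<close> to \<open>b\<close>, and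
  through \<open>w\<close> they would yield a cycle of length at most
  \<open>i + i' + 2\<close>.\<close>

lemma unique_neighbour_not_farther:
  assumes w: "w \<in> layer v j" and a: "a \<in> layer v i" and b: "b \<in> layer v i'"
    and le: "i \<le> j" "i' \<le> j" and girth: "enat (i + i' + 2) < girth G"
    and e: "e \<in> arcs G" "tail G e = w" "head G e = a"
    and f: "f \<in> arcs G" "tail G f = w" "head G f = b"
  shows "a = b"
proof (rule ccontr)
  assume "a \<noteq> b"
  have neq: "a \<noteq> w" "b \<noteq> w" using no_loops e f by metis+
  obtain p where p: "awalk a p v" "length p = i" using a by (auto simp: layer_def)
  obtain q where q: "awalk b q v" "length q = i'" using b by (auto simp: layer_def)
  have w_p: "w \<notin> set (awalk_verts a p)" and w_q: "w \<notin> set (awalk_verts b q)"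
    using not_on_shortest_awalk[OF w] p q le neq by auto
  obtain q' where q': "awalk v q' b" "length q' = i'" "set (awalk_verts v q') = set (awalk_verts b q)"
    using reverse_awalk[OF q(1)] q(2) by auto
  obtain f' where f': "f' \<in> arcs G" "tail G f' = b" "head G f' = w"
    using reverse_arc[OF f(1)] f by metis
  have "awalk a (p @ q') b" using p q' by auto
  moreover have "w \<notin> set (awalk_verts a (p @ q'))"
    using w_p w_q q' set_awalk_verts_append[OF p(1) q'(1)] by simp
  ultimately have "girth G \<le> enat (length (p @ q') + 2)"
    using cycle_through_vertex[OF e f'] \<open>a \<noteq> b\<close> by blast
  with girth p q' show False by simp
qed

text \<open>Every neighbour of \<open>u\<close> lies in a layer up to \<open>Suc i\<close>, and at
  most one arc from \<open>u\<close> leads to a layer up to \<open>i\<close>, since two such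
  neighbours would create a cycle of length at most \<open>2 * i + 2\<close>.\<close>

lemma card_children_ge:
  assumes u: "u \<in> layer v i" and girth: "enat (2 * i + 2) < girth G"
  shows "out_degree G u - 1 \<le> card {e \<in> out_arcs G u. head G e \<in> layer v (Suc i)}"
    (is "_ \<le> card ?C")
proof -
  let ?B = "out_arcs G u - ?C"
  have near: "\<exists>j\<le>i. head G e \<in> layer v j" if e: "e \<in> ?B" for e
  proof -
    obtain p where p: "awalk u p v" "length p = i" using u by (auto simp: layer_def)
    obtain f where f: "f \<in> arcs G" "tail G f = head G e" "head G f = u"
      using reverse_arc[of e] e by auto
    have "awalk (head G e) (f # p) v" using f p by (auto simp: awalk_Cons_iff)
    then obtain j where "j \<le> Suc i" "head G e \<in> layer v j"
      using p(2) by (metis awalk_in_layer length_Cons)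
    with e show ?thesis by (metis (mono_tags, lifting) DiffE le_Suc_eq mem_Collect_eq)
  qed
  have "e = f" if e: "e \<in> ?B" and f: "f \<in> ?B" for e f
  proof -
    obtain j j' where j: "j \<le> i" "head G e \<in> layer v j" "j' \<le> i" "head G f \<in> layer v j'"
      using near[OF e] near[OF f] by blast
    have "enat (j + j' + 2) \<le> enat (2 * i + 2)" using j by simp
    then have "enat (j + j' + 2) < girth G" using girth by (rule le_less_trans)
    then have "head G e = head G f"
      using unique_neighbour_not_farther[OF u j(2) j(4) j(1) j(3)] e f by auto
    with e f show ?thesis by (intro no_multi_arcs) (auto simp: arc_to_ends_def)
  qed
  then have "card ?B \<le> 1"
    using finite_out_arcs[of u] by (auto simp: card_le_Suc0_iff_eq)
  moreover have "card ?B = out_degree G u - card ?C"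
    unfolding out_degree_def by (rule card_Diff_subset) auto
  ultimately show ?thesis by simp
qed

text \<open>Counts the arcs from layer \<open>i\<close> to layer \<open>Suc i\<close>: there are at
  least \<open>d - 1\<close> per tail, and distinct arcs have distinct heads.\<close>

lemma card_layer_Suc_ge:
  assumes deg: "\<And>u. u \<in> verts G \<Longrightarrow> d \<le> out_degree G u" and girth: "enat (2 * i + 2) < girth G"
  shows "(d - 1) * card (layer v i) \<le> card (layer v (Suc i))"
proof -
  let ?C = "\<lambda>u. {e \<in> out_arcs G u. head G e \<in> layer v (Suc i)}"
  have fin: "finite (layer v j)" for j
    using layer_subset_verts finite_verts by (rule finite_subset)
  have "(d - 1) * card (layer v i) = (\<Sum>u\<in>layer v i. d - 1)"
    by simp
  also have "\<dots> \<le> (\<Sum>u\<in>layer v i. card (?C u))"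
  proof (rule sum_mono)
    fix u assume u: "u \<in> layer v i"
    then have "d \<le> out_degree G u" using deg layer_subset_verts by blast
    then show "d - 1 \<le> card (?C u)"
      using card_children_ge[OF u girth] by linarith
  qed
  also have "\<dots> = card (\<Union>u\<in>layer v i. ?C u)"
    using fin by (intro card_UN_disjoint[symmetric]) auto
  also have "\<dots> = card (head G ` (\<Union>u\<in>layer v i. ?C u))"
  proof (rule card_image[symmetric], rule inj_onI)
    fix e f
    assume e: "e \<in> (\<Union>u\<in>layer v i. ?C u)" and f: "f \<in> (\<Union>u\<in>layer v i. ?C u)"
      and eq: "head G e = head G f"
    \<comment> \<open>Reversed, the arcs leave the common child in layer \<open>Suc i\<close>
      towards its two parents in layer \<open>i\<close>, so uniqueness of the nearer neighbour
      applies with cycle bound \<open>i + i + 2\<close>.\<close>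
    obtain e' where e': "e' \<in> arcs G" "tail G e' = head G e" "head G e' = tail G e"
      using reverse_arc[of e] e by auto
    obtain f' where f': "f' \<in> arcs G" "tail G f' = head G e" "head G f' = tail G f"
      using reverse_arc[of f] f eq by auto
    have "tail G e = tail G f"
      by (rule unique_neighbour_not_farther[OF _ _ _ _ _ _ e' f', of v "Suc i" i i])
        (use e f girth in \<open>auto simp: mult_2\<close>)
    with e f eq show "e = f" by (intro no_multi_arcs) (auto simp: arc_to_ends_def)
  qed
  also have "\<dots> \<le> card (layer v (Suc i))"
    using fin by (intro card_mono) auto
  finally show ?thesis .
qed

lemma card_layer_ge:
  assumes deg: "\<And>u. u \<in> verts G \<Longrightarrow> d \<le> out_degree G u" and v: "v \<in> verts G"
    and girth: "enat (2 * i) < girth G"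
  shows "(d - 1) ^ i \<le> card (layer v i)"
  using girth
proof (induction i)
  case 0
  have "finite (layer v 0)"
    using layer_subset_verts finite_verts by (rule finite_subset)
  with layer_0[OF v] show ?case by (auto simp: Suc_le_eq card_gt_0_iff)
next
  case (Suc i)
  have "enat (2 * i) \<le> enat (2 * Suc i)" by simp
  then have "enat (2 * i) < girth G" using Suc.prems by (rule le_less_trans)
  then have "(d - 1) ^ Suc i \<le> (d - 1) * card (layer v i)"
    using Suc.IH by simp
  \<comment> \<open>\<open>2 * Suc i\<close> equals \<open>2 * i + 2\<close>, exactly the length
    that must stay below the girth for layer \<open>i\<close> to grow.\<close>
  also have "\<dots> \<le> card (layer v (Suc i))"
    using Suc.prems by (intro card_layer_Suc_ge deg) auto
  finally show ?case .
qed

lemma layer_subset_k_neighbours: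
  assumes "k \<ge> 1"
  shows "layer v k \<subseteq> k_neighbours G k v"
proof
  fix u assume u: "u \<in> layer v k"
  then obtain p where p: "awalk u p v" "length p = k" by (auto simp: layer_def)
  \<comment> \<open>The root lies in layer 0 only, and \<open>k \<ge> 1\<close>.\<close>
  have "u \<noteq> v"
    using layer_unique[of v v 0 k] layer_0[of v] p u assms by auto
  moreover have "graph_dist G u v \<le> enat (length (awalk_to_apath p))"
    unfolding graph_dist_def by (rule INF_lower) (simp add: apath_awalk_to_apath[OF p(1)])
  then have "graph_dist G u v \<le> enat k"
    using length_awalk_to_apath_le[OF p(1)] p(2) by (meson enat_ord_simps(1) order_trans)
  ultimately show "u \<in> k_neighbours G k v"
    using u layer_subset_verts by (auto simp: k_neighbours_def)
qed

text \<open>The outermost layer \<open>k\<close> alone supplies enough vertices.\<close>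

lemma card_k_neighbours_ge:
  assumes deg: "\<And>u. u \<in> verts G \<Longrightarrow> d \<le> out_degree G u" and v: "v \<in> verts G"
    and girth: "enat (2 * k) < girth G" and "k \<ge> 1"
  shows "(d - 1) ^ k \<le> card (k_neighbours G k v)"
proof -
  have "finite (k_neighbours G k v)" by (simp add: k_neighbours_def)
  then show ?thesis
    using card_layer_ge[OF deg v girth] card_mono[OF _ layer_subset_k_neighbours[OF \<open>k \<ge> 1\<close>]]
    by (meson order_trans)
qed

end

section \<open>The domination bound\<close>

lemma total_domination_number_le:
  "total_dominating G k r S \<Longrightarrow> total_domination_number G k r \<le> card S"
  unfolding total_domination_number_def by (rule Least_le) blast

theorem theorem8:
  fixes G :: "('a,'b) pre_digraph" and k r d n :: nat
  assumes "graph G"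
    and "n = card (verts G)"
    and "k \<ge> 1" and "r \<ge> 1" and "d \<ge> 2"
    and "min_degree G \<ge> enat d"
    and "girth G \<ge> enat (2 * k + 1)"
    and well_defined: "\<exists>S. total_dominating G k r S"
  shows "real (total_domination_number G k r)
           \<le> 2 * real n * real r / (real d - 1) ^ k + real n * real r * exp (- real r / 4)"
proof -
  interpret graph G by fact
  have deg: "d \<le> out_degree G u" if "u \<in> verts G" for u
  proof -
    have "enat d \<le> enat (out_degree G u)"
      using assms(6) INF_lower[OF that] unfolding min_degree_def by (rule order_trans)
    then show ?thesis by simp
  qed
  have "enat (2 * k) < enat (2 * k + 1)" by simp
  then have girth: "enat (2 * k) < girth G" using assms(7) by (rule less_le_trans)
  define D where "D = (real d - 1) ^ k"
  have D_eq: "D = real ((d - 1) ^ k)" using \<open>d \<ge> 2\<close> by (simp add: D_def)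
  have D_pos: "D > 0" using \<open>d \<ge> 2\<close> by (simp add: D_def)
  show ?thesis
  proof (cases "D \<le> 2 * real r")
    \<comment> \<open>The intended probability \<open>2 * r / D\<close> is at least 1 here, so the
      claimed bound is at least \<open>n\<close>. It remains to see that the minimum is attained by
      some subset of \<open>verts G\<close>, which \<open>well_defined\<close> ensures.\<close>
    case True
    obtain S where S: "total_dominating G k r S" using well_defined by blast
    then have "card S \<le> n"
      unfolding assms(2) total_dominating_def by (intro card_mono) auto
    with total_domination_number_le[OF S] have "real (total_domination_number G k r) \<le> real n"
      by simp
    also have "\<dots> \<le> 2 * real n * real r / D"
      using mult_left_mono[OF True, of "real n"] D_pos by (simp add: field_simps)
    also have "\<dots> \<le> 2 * real n * real r / D + real n * real r * exp (- real r / 4)"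
      by simp
    finally show ?thesis by (simp only: D_def)
  next
    case False
    \<comment> \<open>Chosen so that \<open>?p * D = 2 * r\<close>: a neighbourhood of size at least
      \<open>D\<close> then has at least \<open>2 * r\<close> expected hits, twice the required
      number.\<close>
    let ?p = "2 * real r / D"
    have hits: "2 * real r \<le> ?p * real (card (k_neighbours G k v))" if "v \<in> verts G" for v
    proof -
      have "D \<le> real (card (k_neighbours G k v))"
        unfolding D_eq of_nat_le_iff
        using card_k_neighbours_ge[OF deg that girth \<open>k \<ge> 1\<close>] .
      from mult_left_mono[OF this, of ?p] show ?thesis using D_pos by simp
    qed
    have "k_neighbours G k v \<subseteq> verts G" for v by (auto simp: k_neighbours_def)
    moreover have "0 \<le> ?p" "?p \<le> 1" using False D_pos by auto
    ultimately have "\<exists>T\<subseteq>verts G. (\<forall>v\<in>verts G. r \<le> card (k_neighbours G k v \<inter> T)) \<and>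
        real (card T) \<le> real n * ?p + real n * real r * exp (- real r / 4)"
      unfolding assms(2) by (intro exists_small_set_with_many_hits hits) simp_all
    then obtain T where T: "T \<subseteq> verts G" "\<forall>v\<in>verts G. r \<le> card (k_neighbours G k v \<inter> T)"
      and card_T: "real (card T) \<le> real n * ?p + real n * real r * exp (- real r / 4)"
      by blast
    have "total_domination_number G k r \<le> card T"
      using T by (intro total_domination_number_le) (simp add: total_dominating_def)
    with card_T have "real (total_domination_number G k r)
        \<le> real n * ?p + real n * real r * exp (- real r / 4)"
      by linarith
    then show ?thesis by (simp add: D_def mult_ac)
  qed
qed

end
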